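(* Let $A$ be a finite set with $|A|\geq 7$ and let $n$ be a positive integer. If a path on vertex set $\{0,\ldots,n-1\}$ generates $\mathrm{Eq}_n(A)$, then this path contains an edge $\{i,i+1\}$ between two consecutive positions.
   Context: All sets are finite (possibly empty). For $f:B^J\to A^I$ write $f_i(x)=f(x)_i$. For $i\in I$, the input window $\mathcal{W}_f(i)$ is the smallest set $W\subseteq J$ (it exists) such that for all $x,y\in B^J$, $x|_W=y|_W$ implies $f_i(x)=f_i(y)$. A simplicial complex (or complex) over $I$ is a collection of subsets of $I$ (its simplices) closed under taking subsets; the empty set is a simplex of every complex. The communication complex $K_f$ of $f$ is the complex over $I$ in which a non-empty $S\subseteq I$ is a simplex iff $\bigcap_{i\in S}\mathcal{W}_f(i)\neq\emptyset$. A complex $K$ over $I$ generates a language $L\subseteq A^I$ if there exist finite sets $B,J$ and a function $f:B^J\to A^I$ with image exactly $L$ and $K_f\subseteq K$. $\mathrm{Eq}_n(A)\subseteq A^n=A^{\{0,\ldots,n-1\}}$ is the set of strings $w$ such that $w_i=w_{i+1}$ for some $i$ with $0\le i<n-1$. A path on $\{0,\ldots,n-1\}$ is a spanning tree consisting of one root, one leaf (distinct from the root, so $n\geq 2$) and a single branch between them, i.e. for some ordering $v_0,\ldots,v_{n-1}$ of $\{0,\ldots,n-1\}$ its edges are $\{v_j,v_{j+1}\}$ for $0\le j<n-1$. It is regarded as a complex whose simplices are $\emptyset$, the singletons and its edges. *)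

theory Defs
  imports Main "HOL-Library.FuncSet"
begin

text \<open>
  The power \<open>B\<^sup>J\<close> is the set \<open>J \<rightarrow>\<^sub>E B\<close> of extensional functions, and a map
  \<open>B\<^sup>J \<rightarrow> A\<^sup>I\<close> is an HOL function restricted to \<open>J \<rightarrow>\<^sub>E B\<close>; its values outside are ignored.
\<close>

definition determines :: "'b set \<Rightarrow> 'j set \<Rightarrow> (('j \<Rightarrow> 'b) \<Rightarrow> 'i \<Rightarrow> 'a) \<Rightarrow> 'i \<Rightarrow> 'j set \<Rightarrow> bool" where
  "determines B J f i W \<longleftrightarrow> W \<subseteq> J \<and>
     (\<forall>x \<in> J \<rightarrow>\<^sub>E B. \<forall>y \<in> J \<rightarrow>\<^sub>E B. restrict x W = restrict y W \<longrightarrow> f x i = f y i)"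

text \<open>
  \<open>LEAST\<close> refers to the inclusion order. The least element exists when \<open>J\<close> is finite,
  see \<open>input_window_least\<close> below.
\<close>

definition input_window :: "'b set \<Rightarrow> 'j set \<Rightarrow> (('j \<Rightarrow> 'b) \<Rightarrow> 'i \<Rightarrow> 'a) \<Rightarrow> 'i \<Rightarrow> 'j set" where
  "input_window B J f i = (LEAST W. determines B J f i W)"

definition simplicial_complex :: "'i set \<Rightarrow> 'i set set \<Rightarrow> bool" where
  "simplicial_complex I K \<longleftrightarrow>
     K \<subseteq> Pow I \<and> {} \<in> K \<and> (\<forall>S \<in> K. \<forall>T. T \<subseteq> S \<longrightarrow> T \<in> K)"

definition communication_complex ::
  "'i set \<Rightarrow> 'b set \<Rightarrow> 'j set \<Rightarrow> (('j \<Rightarrow> 'b) \<Rightarrow> 'i \<Rightarrow> 'a) \<Rightarrow> 'i set set" where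
  "communication_complex I B J f =
     {S. S \<subseteq> I \<and> (S \<noteq> {} \<longrightarrow> (\<Inter>i\<in>S. input_window B J f i) \<noteq> {})}"

text \<open>
  HOL cannot quantify over types inside a definition, so \<open>B\<close> and \<open>J\<close> range over
  finite sets of naturals; \<open>generatesI\<close> below shows that finite sets of any other
  types yield no further generated languages.
\<close>

definition generates :: "'a set \<Rightarrow> 'i set \<Rightarrow> 'i set set \<Rightarrow> ('i \<Rightarrow> 'a) set \<Rightarrow> bool" where
  "generates A I K L \<longleftrightarrow> simplicial_complex I K \<and>
     (\<exists>(B :: nat set) (J :: nat set) f.
        finite B \<and> finite J \<and> f \<in> (J \<rightarrow>\<^sub>E B) \<rightarrow> (I \<rightarrow>\<^sub>E A) \<and>
        f ` (J \<rightarrow>\<^sub>E B) = L \<and> communication_complex I B J f \<subseteq> K)"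

definition Eq :: "nat \<Rightarrow> 'a set \<Rightarrow> (nat \<Rightarrow> 'a) set" where
  "Eq n A = {w \<in> {..<n} \<rightarrow>\<^sub>E A. \<exists>i. i + 1 < n \<and> w i = w (i + 1)}"

text \<open>A path is given by its set of edges; either end of the ordering may be taken as the root.\<close>

definition is_path :: "nat \<Rightarrow> nat set set \<Rightarrow> bool" where
  "is_path n E \<longleftrightarrow> 2 \<le> n \<and>
     (\<exists>v. bij_betw v {..<n} {..<n} \<and> E = {{v j, v (j + 1)} | j. j + 1 < n})"

definition graph_complex :: "'i set \<Rightarrow> 'i set set \<Rightarrow> 'i set set" where
  "graph_complex I E = {{}} \<union> {{i} | i. i \<in> I} \<union> E"

lemma determines_subset: "determines B J f i W \<Longrightarrow> W \<subseteq> J"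
  unfolding determines_def by (rule conjunct1)

lemma determines_Int:
  assumes "determines B J f i V" "determines B J f i W"
  shows "determines B J f i (V \<inter> W)"
  unfolding determines_def
proof (intro conjI ballI impI)
  show "V \<inter> W \<subseteq> J" using determines_subset[OF assms(1)] by blast
next
  fix x y assume xy: "x \<in> J \<rightarrow>\<^sub>E B" "y \<in> J \<rightarrow>\<^sub>E B"
    and eq: "restrict x (V \<inter> W) = restrict y (V \<inter> W)"
  define z where "z = (\<lambda>j. if j \<in> V then x j else y j)"
  have VW: "V \<subseteq> J" "W \<subseteq> J" using assms by (simp_all add: determines_subset)
  have z: "z \<in> J \<rightarrow>\<^sub>E B"
    using xy VW unfolding z_def PiE_iff extensional_def by auto
  have e: "x j = y j" if "j \<in> V" "j \<in> W" for j
    using fun_cong[OF eq, of j] that by simp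
  have "restrict x V = restrict z V" by (auto simp: z_def restrict_def fun_eq_iff)
  moreover have "restrict z W = restrict y W" by (auto simp: z_def restrict_def fun_eq_iff e)
  ultimately show "f x i = f y i"
    using assms xy z unfolding determines_def by (metis (no_types, lifting))
qed

lemma determines_full: "determines B J f i J"
proof -
  have "x = y" if "x \<in> J \<rightarrow>\<^sub>E B" "y \<in> J \<rightarrow>\<^sub>E B" "restrict x J = restrict y J" for x y
    using that by (metis PiE_restrict)
  then show ?thesis unfolding determines_def by blast
qed

lemma input_window_least:
  assumes "finite J"
  shows "determines B J f i (input_window B J f i)"
    and "determines B J f i W \<Longrightarrow> input_window B J f i \<subseteq> W"
proof -
  let ?P = "determines B J f i"
  have fin: "finite {W. ?P W}"
    by (rule finite_subset[of _ "Pow J"]) (use assms in \<open>auto dest: determines_subset\<close>)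
  have *: "?P (\<Inter>F)" if "finite F" "F \<noteq> {}" "F \<subseteq> {W. ?P W}" for F
    using that
  proof (induction F rule: finite_ne_induct)
    case (insert V F)
    then show ?case using determines_Int[of B J f i V "\<Inter>F"] by simp
  qed simp
  have least: "?P (\<Inter>{W. ?P W})"
    by (rule *[OF fin]) (use determines_full[of B J f i] in auto)
  have eq: "input_window B J f i = \<Inter>{W. ?P W}"
    unfolding input_window_def by (rule Least_equality) (use least in auto)
  show "?P (input_window B J f i)" using least eq by simp
  show "?P W \<Longrightarrow> input_window B J f i \<subseteq> W" using eq by auto
qed

lemma simplicial_complex_communication_complex:
  "simplicial_complex I (communication_complex I B J f)"
  unfolding simplicial_complex_def communication_complex_def by blast

lemma simplicial_complex_path:
  assumes "is_path n E"
  shows "simplicial_complex {..<n} (graph_complex {..<n} E)"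
proof -
  obtain v where v: "bij_betw v {..<n} {..<n}" "E = {{v j, v (j + 1)} | j. j + 1 < n}"
    using assms by (auto simp: is_path_def)
  have vn: "v j < n" if "j < n" for j using bij_betwE[OF v(1)] that by auto
  have "T \<in> graph_complex {..<n} E" if "S \<in> graph_complex {..<n} E" "T \<subseteq> S" for S T
  proof (cases "S \<in> E")
    case True
    then obtain j where j: "S = {v j, v (j + 1)}" "j + 1 < n" using v by auto
    then have "T = {} \<or> T = {v j} \<or> T = {v (j + 1)} \<or> T = S" using that by blast
    then show ?thesis using True j vn[of j] vn[of "j + 1"] unfolding graph_complex_def by auto
  next
    case False
    then have "S = {} \<or> (\<exists>i<n. S = {i})" using that by (auto simp: graph_complex_def)
    then have "T = {} \<or> (\<exists>i<n. T = {i})" using that by (auto simp: subset_singleton_iff)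
    then show ?thesis unfolding graph_complex_def by auto
  qed
  moreover have "graph_complex {..<n} E \<subseteq> Pow {..<n}"
    using v(2) vn by (auto simp: graph_complex_def)
  ultimately show ?thesis unfolding simplicial_complex_def by (auto simp: graph_complex_def)
qed

lemma generatesI:
  fixes B :: "'b set" and J :: "'j set"
  assumes K: "simplicial_complex I K" and fin: "finite B" "finite J"
    and f: "f \<in> (J \<rightarrow>\<^sub>E B) \<rightarrow> (I \<rightarrow>\<^sub>E A)" "f ` (J \<rightarrow>\<^sub>E B) = L"
    and sub: "communication_complex I B J f \<subseteq> K"
  shows "generates A I K L"
proof -
  obtain g h where g: "bij_betw g J {..<card J}" and h: "bij_betw h B {..<card B}"
    using fin by (metis ex_bij_betw_finite_nat atLeast0LessThan)
  let ?M = "{..<card J}" and ?C = "{..<card B}"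
  define \<phi> where "\<phi> x = (\<lambda>j\<in>J. inv_into B h (x (g j)))" for x :: "nat \<Rightarrow> nat"
  define f' where "f' x = f (\<phi> x)" for x
  have hi: "inv_into B h c \<in> B" "h (inv_into B h c) = c" if "c \<in> ?C" for c
    using that h by (metis bij_betw_def inv_into_into) (metis that h bij_betw_inv_into_right)
  have gJ: "g j \<in> ?M" if "j \<in> J" for j using bij_betwE[OF g] that by blast
  have hB: "h b \<in> ?C" if "b \<in> B" for b using bij_betwE[OF h] that by blast
  have \<phi>_in: "\<phi> x \<in> J \<rightarrow>\<^sub>E B" if "x \<in> ?M \<rightarrow>\<^sub>E ?C" for x
    unfolding \<phi>_def restrict_PiE_iff using PiE_mem[OF that] gJ hi by blast
  have \<phi>_surj: "\<exists>x \<in> ?M \<rightarrow>\<^sub>E ?C. \<phi> x = y" if y: "y \<in> J \<rightarrow>\<^sub>E B" for y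
  proof (rule bexI)
    let ?x = "\<lambda>m\<in>?M. h (y (inv_into J g m))"
    have "inv_into J g m \<in> J" if "m \<in> ?M" for m using that g by (metis bij_betw_def inv_into_into)
    then show "?x \<in> ?M \<rightarrow>\<^sub>E ?C" unfolding restrict_PiE_iff using PiE_mem[OF y] hB by blast
    show "\<phi> ?x = y"
    proof
      fix j show "\<phi> ?x j = y j"
      proof (cases "j \<in> J")
        case True
        have "?x (g j) = h (y j)"
          using gJ[OF True] bij_betw_inv_into_left[OF g True] by simp
        then show ?thesis
          using True bij_betw_inv_into_left[OF h PiE_mem[OF y True]] by (simp add: \<phi>_def)
      next
        case False
        then show ?thesis using PiE_arb[OF y False] by (simp add: \<phi>_def)
      qed
    qed
  qed
  have \<phi>_image: "\<phi> ` (?M \<rightarrow>\<^sub>E ?C) = J \<rightarrow>\<^sub>E B" using \<phi>_in \<phi>_surj by blast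
  have img: "f' ` (?M \<rightarrow>\<^sub>E ?C) = L"
    using f(2) unfolding \<phi>_image[symmetric] f'_def by (simp add: image_image)
  have win: "input_window ?C ?M f' i \<subseteq> g ` input_window B J f i" for i
  proof (rule input_window_least(2))
    let ?W = "input_window B J f i"
    have W: "determines B J f i ?W" by (rule input_window_least(1)[OF fin(2)])
    then have WJ: "?W \<subseteq> J" by (rule determines_subset)
    show "determines ?C ?M f' i (g ` ?W)"
      unfolding determines_def
    proof (intro conjI ballI impI)
      show "g ` ?W \<subseteq> ?M" using WJ gJ by blast
      fix x y assume xy: "x \<in> ?M \<rightarrow>\<^sub>E ?C" "y \<in> ?M \<rightarrow>\<^sub>E ?C"
        and eq: "restrict x (g ` ?W) = restrict y (g ` ?W)"
      have "x (g j) = y (g j)" if "j \<in> ?W" for j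
        using fun_cong[OF eq, of "g j"] that by simp
      then have "restrict (\<phi> x) ?W = restrict (\<phi> y) ?W"
        using WJ by (auto simp: \<phi>_def restrict_def fun_eq_iff)
      then show "f' x i = f' y i"
        using W \<phi>_in xy unfolding f'_def determines_def by blast
    qed
  qed simp
  have "communication_complex I ?C ?M f' \<subseteq> communication_complex I B J f"
  proof
    fix S assume S: "S \<in> communication_complex I ?C ?M f'"
    have "(\<Inter>i\<in>S. input_window B J f i) \<noteq> {}" if ne: "S \<noteq> {}"
    proof -
      obtain m where m: "\<forall>i\<in>S. m \<in> input_window ?C ?M f' i"
        using S ne by (auto simp: communication_complex_def)
      have "inv_into J g m \<in> input_window B J f i" if iS: "i \<in> S" for i
      proof -
        obtain j where j: "j \<in> input_window B J f i" "m = g j"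
          using subsetD[OF win bspec[OF m iS]] by (rule imageE)
        moreover have "j \<in> J"
          using j determines_subset[OF input_window_least(1)[OF fin(2), of B f i]] by blast
        ultimately show ?thesis using bij_betw_inv_into_left[OF g] by simp
      qed
      then show ?thesis by blast
    qed
    then show "S \<in> communication_complex I B J f" using S by (auto simp: communication_complex_def)
  qed
  then have sub': "communication_complex I ?C ?M f' \<subseteq> K" using sub by blast
  have "f' \<in> (?M \<rightarrow>\<^sub>E ?C) \<rightarrow> (I \<rightarrow>\<^sub>E A)"
    unfolding f'_def by (rule Pi_I) (rule funcset_mem[OF f(1) \<phi>_in])
  then show ?thesis unfolding generates_def using K img sub' by blast
qed

end

theory Submission
  imports Defs
begin

text \<open>
  Suppose no edge of the path joins consecutive positions, and list its vertices as
  \<open>v\<^sub>0, \<dots>, v\<^sub>n\<^sub>-\<^sub>1\<close>. Every input coordinate is seen by at most two vertices, neighbours on the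
  path, so two inputs \<open>x\<close> and \<open>y\<close> can be spliced at \<open>v\<^sub>j\<close>: the vertices before \<open>v\<^sub>j\<close> output what
  they do on \<open>x\<close>, those after \<open>v\<^sub>j\<close> what they do on \<open>y\<close>, and only the letter at \<open>v\<^sub>j\<close> is not
  controlled. Let the words of \<open>x\<close> and \<open>y\<close> use disjoint two-letter palettes \<open>P\<close> and \<open>Q\<close>, with all
  their equalities crossing the cuts of the path just before and just after \<open>v\<^sub>j\<close>, respectively.
  The spliced word has an equality, so the letter at \<open>v\<^sub>j\<close> lies in \<open>P \<union> Q\<close>; by induction on \<open>j\<close> it
  lies in \<open>Q\<close>. Otherwise a further splice at \<open>v\<^sub>j\<^sub>-\<^sub>1\<close> with an input \<open>z\<close> of a third palette
  yields letters of \<open>P\<close> at both \<open>v\<^sub>j\<^sub>-\<^sub>1\<close> and \<open>v\<^sub>j\<close>, which are not consecutive positions, while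
  all other letters lie outside \<open>P\<close>; then no equality is left. At the last vertex there is nothing
  after \<open>v\<^sub>j\<close>, the letter is that of \<open>x\<close>, and \<open>P \<inter> Q = {}\<close> gives the contradiction.
\<close>

section \<open>Outputs determined by a set of inputs\<close>

lemma determinesD:
  assumes "determines B J f i W" "x \<in> J \<rightarrow>\<^sub>E B" "y \<in> J \<rightarrow>\<^sub>E B" "\<And>t. t \<in> W \<Longrightarrow> x t = y t"
  shows "f x i = f y i"
proof -
  have "restrict x W = restrict y W" using assms(4) by (rule restrict_ext)
  then show ?thesis using assms(1-3) unfolding determines_def by blast
qed

lemma determines_mono:
  assumes "determines B J f i V" "V \<subseteq> W" "W \<subseteq> J"
  shows "determines B J f i W"
  unfolding determines_def
proof (intro conjI ballI impI)
  fix x y assume xy: "x \<in> J \<rightarrow>\<^sub>E B" "y \<in> J \<rightarrow>\<^sub>E B" "restrict x W = restrict y W"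
  have "x t = y t" if "t \<in> V" for t
    using fun_cong[OF xy(3), of t] subsetD[OF assms(2) that] by simp
  then show "f x i = f y i" by (rule determinesD[OF assms(1) xy(1,2)])
qed (rule assms(3))

text \<open>\<open>rank\<close> is the position along the path, and \<open>U j\<close> holds the
  inputs to the left of the cut at rank \<open>j\<close>. \<open>far\<close> expresses that no path
  edge joins consecutive positions.\<close>

locale sweep =
  fixes n :: nat and A :: "'a set" and B :: "'b set" and J :: "'j set"
    and f :: "('j \<Rightarrow> 'b) \<Rightarrow> nat \<Rightarrow> 'a" and rank :: "nat \<Rightarrow> nat" and U :: "nat \<Rightarrow> 'j set"
  assumes n2: "2 \<le> n"
    and rank: "bij_betw rank {..<n} {..<n}"
    and far: "i + 1 < n \<Longrightarrow> rank i + 1 \<noteq> rank (i + 1) \<and> rank (i + 1) + 1 \<noteq> rank i"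
    and image: "f ` (J \<rightarrow>\<^sub>E B) = Eq n A"
    and U_0: "U 0 = {}" and U_last: "U (n - 1) = J"
    and before: "\<lbrakk>i < n; rank i < j; j < n\<rbrakk> \<Longrightarrow> determines B J f i (U j)"
    and after: "\<lbrakk>i < n; j < rank i\<rbrakk> \<Longrightarrow> determines B J f i (J - U j)"
begin

definition splice :: "nat \<Rightarrow> ('j \<Rightarrow> 'b) \<Rightarrow> ('j \<Rightarrow> 'b) \<Rightarrow> 'j \<Rightarrow> 'b" where
  "splice j x y = (\<lambda>t. if t \<in> U j then x t else y t)"

text \<open>For \<open>j = 0\<close> and \<open>j \<ge> n\<close> the cut is trivial, and the equalities may be anywhere.\<close>

definition cut_word :: "nat \<Rightarrow> 'a set \<Rightarrow> (nat \<Rightarrow> 'a) \<Rightarrow> bool" where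
  "cut_word j P w \<longleftrightarrow> (\<forall>i<n. w i \<in> P) \<and>
     (0 < j \<and> j < n \<longrightarrow>
       (\<forall>i. i + 1 < n \<and> w i = w (i + 1) \<longrightarrow> (rank i < j) \<noteq> (rank (i + 1) < j)))"

lemma cut_wordD:
  assumes "cut_word j P w" "0 < j" "j < n" "i < n" "k < n" "i = k + 1 \<or> k = i + 1" "w i = w k"
  shows "(rank i < j) \<noteq> (rank k < j)"
  using assms(6)
proof
  assume "i = k + 1"
  then show ?thesis using assms unfolding cut_word_def by metis
next
  assume "k = i + 1"
  then show ?thesis using assms unfolding cut_word_def by metis
qed

section \<open>Splices of two inputs\<close>

lemma splice_in: "\<lbrakk>x \<in> J \<rightarrow>\<^sub>E B; y \<in> J \<rightarrow>\<^sub>E B\<rbrakk> \<Longrightarrow> splice j x y \<in> J \<rightarrow>\<^sub>E B"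
  unfolding splice_def PiE_iff extensional_def by auto

lemma splice_before:
  assumes "x \<in> J \<rightarrow>\<^sub>E B" "y \<in> J \<rightarrow>\<^sub>E B" "i < n" "rank i < j" "j < n"
  shows "f (splice j x y) i = f x i"
  by (rule determinesD[OF before[OF assms(3-5)] splice_in[OF assms(1,2)] assms(1)])
    (simp add: splice_def)

lemma splice_after:
  assumes "x \<in> J \<rightarrow>\<^sub>E B" "y \<in> J \<rightarrow>\<^sub>E B" "i < n" "j < rank i"
  shows "f (splice j x y) i = f y i"
  by (rule determinesD[OF after[OF assms(3,4)] splice_in[OF assms(1,2)] assms(2)])
    (simp add: splice_def)

text \<open>\<open>U (Suc j)\<close> already fixes the letter at rank \<open>j\<close>, and on it
  the inner splice agrees with \<open>x\<close>. This brings the double splice within reach of the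
  induction hypothesis.\<close>

lemma splice_splice_middle:
  assumes "x \<in> J \<rightarrow>\<^sub>E B" "y \<in> J \<rightarrow>\<^sub>E B" "z \<in> J \<rightarrow>\<^sub>E B" "i < n" "rank i = j" "Suc j < n"
  shows "f (splice j z (splice (Suc j) x y)) i = f (splice j z x) i"
  by (rule determinesD[OF before[OF assms(4) _ assms(6)]])
    (use assms splice_in in \<open>auto simp: splice_def\<close>)

section \<open>Equal neighbours and the cuts of the path\<close>

lemma Eq_cases:
  assumes "x \<in> J \<rightarrow>\<^sub>E B"
  obtains i k where "i < n" "k < n" "rank i + 2 \<le> rank k" "f x i = f x k"
    "i = k + 1 \<or> k = i + 1"
proof -
  have "f x \<in> Eq n A" using image assms by blast
  then obtain i where i: "i + 1 < n" "f x i = f x (i + 1)" unfolding Eq_def by blast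
  have "rank i \<noteq> rank (i + 1)"
    using rank i(1) unfolding bij_betw_def inj_on_def by force
  then have "rank i + 2 \<le> rank (i + 1) \<or> rank (i + 1) + 2 \<le> rank i" using far[OF i(1)] by linarith
  then show ?thesis using that[of i "i + 1"] that[of "i + 1" i] i by auto
qed

lemma crossing_ex:
  assumes "0 < j" "j < n"
  shows "\<exists>p. p + 1 < n \<and> (rank p < j) \<noteq> (rank (p + 1) < j)"
proof (rule ccontr)
  assume c: "\<not> ?thesis"
  \<comment> \<open>Without a crossing all positions lie on the side of position 0, yet ranks 0 and
    \<open>j\<close> are on different sides.\<close>
  have same: "i < n \<Longrightarrow> (rank i < j) = (rank 0 < j)" for i
  proof (induction i)
    case (Suc i)
    then show ?case using c by auto
  qed simp
  obtain i where "i < n" "rank i = 0" using rank assms unfolding bij_betw_def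
    by (metis imageE lessThan_iff less_trans)
  moreover obtain k where "k < n" "rank k = j" using rank assms unfolding bij_betw_def
    by (metis imageE lessThan_iff)
  ultimately show False using same[of i] same[of k] assms by simp
qed

lemma cut_word_ex:
  assumes "P \<subseteq> A" "card P = 2"
  obtains x where "x \<in> J \<rightarrow>\<^sub>E B" "cut_word j P (f x)"
proof -
  obtain a b where ab: "P = {a, b}" "a \<noteq> b" using assms(2) by (meson card_2_iff)
  obtain p where p: "p + 1 < n" "0 < j \<and> j < n \<longrightarrow> (rank p < j) \<noteq> (rank (p + 1) < j)"
  proof (cases "0 < j \<and> j < n")
    case True
    then show ?thesis using crossing_ex that by blast
  next
    case False
    then show ?thesis using that[of 0] n2 by auto
  qed
  \<comment> \<open>The letters alternate by parity and the phase flips after \<open>p\<close>,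
    which leaves a single equality, at \<open>p\<close>.\<close>
  define w where "w = (\<lambda>i\<in>{..<n}. if even i = (i \<le> p) then a else b)"
  have eq: "w i = w (i + 1) \<longleftrightarrow> i = p" if "i + 1 < n" for i
    using that ab(2) by (auto simp: w_def)
  have "w \<in> {..<n} \<rightarrow>\<^sub>E A" using ab(1) assms(1) by (auto simp: w_def)
  then have "w \<in> Eq n A" unfolding Eq_def using p(1) eq[OF p(1)] by blast
  then obtain x where "x \<in> J \<rightarrow>\<^sub>E B" "f x = w" using image by force
  moreover have "cut_word j P w"
    unfolding cut_word_def using p(2) eq ab(1) by (auto simp: w_def)
  ultimately show ?thesis using that by blast
qed

section \<open>The letter at the splice vertex\<close>

lemma splice_letter:
  assumes "x \<in> J \<rightarrow>\<^sub>E B" "y \<in> J \<rightarrow>\<^sub>E B" "cut_word j P (f x)" "cut_word (Suc j) Q (f y)"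
    and "P \<inter> Q = {}" "m < n" "rank m = j" "j < n" "0 < j"
  shows "f (splice j x y) m \<in> P \<union> Q"
proof -
  obtain i k where ik: "i < n" "k < n" "rank i + 2 \<le> rank k"
      "f (splice j x y) i = f (splice j x y) k" "i = k + 1 \<or> k = i + 1"
    using splice_in[OF assms(1,2)] by (rule Eq_cases)
  have rk: "rank k < n" using bij_betwE[OF rank] ik(2) by auto
  have inj: "i' = m" if "i' < n" "rank i' = j" for i'
    using rank that assms(6,7) unfolding bij_betw_def inj_on_def by auto
  have P: "f x i' \<in> P" and Q: "f y i' \<in> Q" if "i' < n" for i'
    using assms(3,4) that unfolding cut_word_def by auto
  have xi: "f (splice j x y) i' = f x i'" if "i' < n" "rank i' < j" for i'
    using splice_before[OF assms(1,2) that assms(8)] .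
  have yi: "f (splice j x y) i' = f y i'" if "i' < n" "j < rank i'" for i'
    using splice_after[OF assms(1,2) that] .
  \<comment> \<open>Only the second and fourth cases involve \<open>m\<close>. In the others the
    equality would miss its cut or join disjoint palettes.\<close>
  consider "rank k < j" | "rank k = j" | "rank i < j" "j < rank k" | "rank i = j" | "j < rank i"
    by linarith
  then show ?thesis
  proof cases
    case 1
    then have "f x i = f x k" using ik(1-4) xi by simp
    then show ?thesis using cut_wordD[OF assms(3,9,8) ik(1,2,5)] ik(3) 1 by simp
  next
    case 2
    then have "f (splice j x y) m = f x i" using ik(1-4) xi[of i] inj[of k] by simp
    then show ?thesis using P ik(1) by simp
  next
    case 3
    then have "f x i = f y k" using ik(1-4) xi yi by simp
    then show ?thesis using P[OF ik(1)] Q[OF ik(2)] assms(5) by auto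
  next
    case 4
    then have "f (splice j x y) m = f y k" using ik(1-4) yi[of k] inj[of i] by simp
    then show ?thesis using Q ik(2) by simp
  next
    case 5
    then have "f y i = f y k" using ik(1-4) yi by simp
    moreover have "Suc j < n" using 5 ik rk by simp
    ultimately show ?thesis using cut_wordD[OF assms(4) _ _ ik(1,2,5)] ik(3) 5 by simp
  qed
qed

lemma splice_letter_right:
  assumes "finite A" "6 \<le> card A"
    and "x \<in> J \<rightarrow>\<^sub>E B" "y \<in> J \<rightarrow>\<^sub>E B" "cut_word j P (f x)" "cut_word (Suc j) Q (f y)"
    and "P \<subseteq> A" "card P = 2" "Q \<subseteq> A" "card Q = 2" "P \<inter> Q = {}" "m < n" "rank m = j" "j < n"
  shows "f (splice j x y) m \<in> Q"
  using assms(3-)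
proof (induction j arbitrary: x y P Q m)
  case 0
  have "splice 0 x y = y" by (simp add: splice_def U_0)
  then show ?case using 0 unfolding cut_word_def by auto
next
  case (Suc j)
  \<comment> \<open>Six letters leave room for a third palette outside
    \<open>P \<union> Q\<close>.\<close>
  have "card (P \<union> Q) = 4" using Suc.prems assms(1)
    by (simp add: card_Un_disjoint finite_subset)
  then have "2 \<le> card (A - (P \<union> Q))"
    using assms(1,2) Suc.prems by (subst card_Diff_subset) (auto intro: finite_subset)
  then obtain R where R: "R \<subseteq> A - (P \<union> Q)" "card R = 2" by (meson obtain_subset_with_card_n)
  obtain z where z: "z \<in> J \<rightarrow>\<^sub>E B" "cut_word j R (f z)" using cut_word_ex[of R j] R by blast
  let ?h = "splice (Suc j) x y"
  \<comment> \<open>By rank, \<open>?g\<close> yields letters of \<open>R\<close> below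
    \<open>j\<close>, of \<open>P\<close> at \<open>j\<close>, the letter in question at
    \<open>Suc j\<close>, and letters of \<open>Q\<close> above.\<close>
  let ?g = "splice j z ?h"
  have h: "?h \<in> J \<rightarrow>\<^sub>E B" using splice_in Suc.prems by blast
  have PQ: "f ?h m \<in> P \<union> Q" by (rule splice_letter) (use Suc.prems in auto)
  have inj: "i = m" if "i < n" "rank i = Suc j" for i
    using rank that Suc.prems unfolding bij_betw_def inj_on_def by auto
  have gR: "f ?g i = f z i" "f z i \<in> R" if "i < n" "rank i < j" for i
    using splice_before[OF z(1) h that] Suc.prems that z(2) by (auto simp: cut_word_def)
  have gP: "f ?g i \<in> P" if i: "i < n" "rank i = j" for i
  proof -
    have "f (splice j z x) i \<in> P"
      by (rule Suc.IH[OF z(1) Suc.prems(1) z(2) Suc.prems(3)]) (use R Suc.prems i in auto)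
    then show ?thesis using splice_splice_middle Suc.prems z(1) i by simp
  qed
  have gm: "f ?g m = f ?h m" using splice_after[OF z(1) h] Suc.prems by simp
  have gQ: "f ?g i = f y i" "f y i \<in> Q" if "i < n" "Suc j < rank i" for i
    using splice_after[OF z(1) h, of i j] splice_after[of x y i "Suc j"] Suc.prems that
    by (auto simp: cut_word_def)
  obtain i k where ik: "i < n" "k < n" "rank i + 2 \<le> rank k" "f ?g i = f ?g k"
      "i = k + 1 \<or> k = i + 1"
    using splice_in[OF z(1) h] by (rule Eq_cases)
  have rk: "rank k < n" using bij_betwE[OF rank] ik(2) by auto
  \<comment> \<open>The rank gap of two excludes a match between ranks \<open>j\<close> and
    \<open>Suc j\<close>. Only \<open>rank i = Suc j\<close> survives, where the letter equals one
    of \<open>Q\<close>.\<close>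
  consider "rank k < j" | "rank i < j" "rank k = j" | "rank i < j" "rank k = Suc j"
    | "rank i < j" "Suc j < rank k" | "rank i = j" | "rank i = Suc j" | "Suc j < rank i"
    using ik(3) by linarith
  then show ?case
  proof cases
    case 1
    then have "f z i = f z k" using ik(1-4) gR by simp
    then show ?thesis using cut_wordD[OF z(2) _ _ ik(1,2,5)] ik(3) 1 Suc.prems(12) by simp
  next
    case 2
    then have "f ?g i \<in> R" "f ?g k \<in> P" using gR gP ik(1,2) by simp_all
    then show ?thesis using ik(4) R by auto
  next
    case 3
    then have "f ?g i \<in> R" "f ?g k \<in> P \<union> Q" using gR gm inj PQ ik(1,2) by simp_all
    then show ?thesis using ik(4) R by auto
  next
    case 4
    then have "f ?g i \<in> R" "f ?g k \<in> Q" using gR gQ ik(1,2) by simp_all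
    then show ?thesis using ik(4) R by auto
  next
    case 5
    then have "f ?g i \<in> P" "f ?g k \<in> Q" using gP[OF ik(1)] gQ[OF ik(2)] ik(3) by simp_all
    then show ?thesis using ik(4) Suc.prems(9) by auto
  next
    case 6
    then have "f ?h m = f ?g i" "f ?g k \<in> Q"
      using gm inj[OF ik(1)] gQ[OF ik(2)] ik(3) by simp_all
    then show ?thesis using ik(4) by simp
  next
    case 7
    then have "f y i = f y k" using ik(1-4) gQ by simp
    moreover have "Suc (Suc j) < n" using 7 ik rk by simp
    ultimately show ?thesis using cut_wordD[OF Suc.prems(4) _ _ ik(1,2,5)] ik(3) 7 by simp
  qed
qed

lemma card_alphabet_less:
  assumes "finite A"
  shows "card A < 6"
proof (rule ccontr)
  assume "\<not> ?thesis"
  then have A: "6 \<le> card A" by simp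
  obtain P where P: "P \<subseteq> A" "card P = 2" using obtain_subset_with_card_n[of 2 A] A by auto
  have "2 \<le> card (A - P)" using P A assms by (subst card_Diff_subset) (auto intro: finite_subset)
  then obtain Q where Q: "Q \<subseteq> A - P" "card Q = 2" by (meson obtain_subset_with_card_n)
  obtain x where x: "x \<in> J \<rightarrow>\<^sub>E B" "cut_word (n - 1) P (f x)" using cut_word_ex P by blast
  \<comment> \<open>No vertex comes after the last one, so this cut is trivial.\<close>
  obtain y where y: "y \<in> J \<rightarrow>\<^sub>E B" "cut_word (Suc (n - 1)) Q (f y)"
    using cut_word_ex[of Q] Q by blast
  have "n - 1 \<in> rank ` {..<n}" using n2 bij_betw_imp_surj_on[OF rank] by simp
  then obtain m where m: "m < n" "rank m = n - 1" by auto
  have "f (splice (n - 1) x y) m \<in> Q"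
    by (rule splice_letter_right[OF assms A x(1) y(1) x(2) y(2)]) (use P Q m n2 in auto)
  moreover have "splice (n - 1) x y = x"
    unfolding splice_def U_last using PiE_arb[OF x(1)] PiE_arb[OF y(1)] by fastforce
  moreover have "f x m \<in> P" using x(2) m(1) unfolding cut_word_def by blast
  ultimately show False using Q(1) by auto
qed

end

section \<open>The cuts of a path without consecutive edges\<close>

theorem theorem4p1:
  fixes A :: "'a set" and n :: nat and E :: "nat set set"
  assumes "finite A" and "card A \<ge> 7" and "n > 0"
    and "is_path n E"
    and "generates A {..<n} (graph_complex {..<n} E) (Eq n A)"
  shows "\<exists>i. i + 1 < n \<and> {i, i + 1} \<in> E"
proof (rule ccontr)
  assume no: "\<not> ?thesis"
  obtain v where n2: "2 \<le> n" and v: "bij_betw v {..<n} {..<n}"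
    and E: "E = {{v j, v (j + 1)} | j. j + 1 < n}"
    using assms(4) unfolding is_path_def by blast
  obtain B :: "nat set" and J :: "nat set" and f where fin: "finite J"
    and img: "f ` (J \<rightarrow>\<^sub>E B) = Eq n A"
    and sub: "communication_complex {..<n} B J f \<subseteq> graph_complex {..<n} E"
    using assms(5) unfolding generates_def by blast
  let ?W = "input_window B J f"
  define rank where "rank = inv_into {..<n} v"
  have rank: "bij_betw rank {..<n} {..<n}"
    unfolding rank_def using v by (rule bij_betw_inv_into)
  have vr: "v (rank i) = i" if "i < n" for i
    unfolding rank_def using bij_betw_inv_into_right[OF v] that by simp
  have rv: "rank (v j) = j" if "j < n" for j
    unfolding rank_def using bij_betw_inv_into_left[OF v] that by simp
  have rn: "rank i < n" if "i < n" for i using bij_betwE[OF rank] that by auto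
  \<comment> \<open>An input shared by both windows would make \<open>{i, k}\<close> an edge, whose
    ranks differ by 1.\<close>
  have disj: "?W i \<inter> ?W k = {}" if ik: "i < n" "k < n" "rank i + 2 \<le> rank k" for i k
  proof (rule ccontr)
    assume "?W i \<inter> ?W k \<noteq> {}"
    then have "{i, k} \<in> communication_complex {..<n} B J f"
      using ik by (simp add: communication_complex_def)
    moreover have "i \<noteq> k" using ik by auto
    ultimately have "{i, k} \<in> E"
      using sub unfolding graph_complex_def by (auto simp: doubleton_eq_iff)
    then obtain j where "{i, k} = {v j, v (j + 1)}" "j + 1 < n" unfolding E by blast
    then show False using ik rv[of j] rv[of "j + 1"] by (auto simp: doubleton_eq_iff)
  qed
  \<comment> \<open>Inputs seen only by the last vertex must lie before its cut, hence the case distinction.\<close>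
  define U where "U j = (if n \<le> j + 1 then J else \<Union>i\<in>{i. i < n \<and> rank i < j}. ?W i)" for j
  have WJ: "?W i \<subseteq> J" for i using determines_subset[OF input_window_least(1)[OF fin]] .
  have UJ: "U j \<subseteq> J" for j using WJ unfolding U_def by auto
  interpret sweep n A B J f rank U
  proof
    fix i assume i: "i + 1 < n"
    have "rank i + 1 \<noteq> rank (i + 1)"
    proof
      assume "rank i + 1 = rank (i + 1)"
      then have "{i, i + 1} \<in> E"
        unfolding E using vr[of i] vr[of "i + 1"] rn[of "i + 1"] i
        by (intro CollectI exI[of _ "rank i"]) (metis add_lessD1)
      then show False using no i by blast
    qed
    moreover have "rank (i + 1) + 1 \<noteq> rank i"
    proof
      assume "rank (i + 1) + 1 = rank i"
      then have "{i, i + 1} \<in> E"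
        unfolding E using vr[of i] vr[of "i + 1"] rn[of i] i
        by (intro CollectI exI[of _ "rank (i + 1)"]) (metis add_lessD1 insert_commute)
      then show False using no i by blast
    qed
    ultimately show "rank i + 1 \<noteq> rank (i + 1) \<and> rank (i + 1) + 1 \<noteq> rank i" by blast
  next
    fix i j assume "i < n" "rank i < j" "j < n"
    then have "?W i \<subseteq> (\<Union>k\<in>{k. k < n \<and> rank k < j}. ?W k)" by blast
    then have "?W i \<subseteq> U j" unfolding U_def using WJ[of i] by simp
    then show "determines B J f i (U j)"
      by (rule determines_mono[OF input_window_least(1)[OF fin]]) (rule UJ)
  next
    fix i j assume ij: "i < n" "j < rank i"
    then have U: "U j = (\<Union>k\<in>{k. k < n \<and> rank k < j}. ?W k)"
      using rn[OF ij(1)] by (simp add: U_def)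
    have "?W k \<inter> ?W i = {}" if "k < n" "rank k < j" for k
      using disj[OF that(1) ij(1)] that(2) ij(2) by linarith
    then have "?W i \<inter> U j = {}" unfolding U by blast
    then have "?W i \<subseteq> J - U j" using WJ by blast
    then show "determines B J f i (J - U j)"
      by (rule determines_mono[OF input_window_least(1)[OF fin]]) blast
  qed (use n2 rank img in \<open>simp_all add: U_def\<close>)
  show False using card_alphabet_less[OF assms(1)] assms(2) by simp
qed

end
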